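(* Suppose that $A$ and $S$ are lattices in $\mathbb{R}^k$ and $\mathbb{R}^n$, respectively, and that $r$, $p$ and $\Gamma$ are supermodular. Then the set of optimal solutions of the discounted dynamic programming problem, $$G(s)=\operatorname{argmax}_{a\in\Gamma(s)}\; r(s,a)+\beta\int_S V(s')\,p(s,a,ds'),$$ is ascending (as a correspondence from $S$ to $A$).
   Context: Discounted dynamic programming model (infinite horizon). $S\subseteq\mathbb{R}^n$ (states, a separable complete metric space) and $A\subseteq\mathbb{R}^k$ (actions) are measurable (measurable means Borel). $\Gamma:S\to2^A$ gives the feasible actions. $p(s,a,\cdot)$ is a probability measure on $S$ for each $(s,a)\in S\times A$, with $p(\cdot,\cdot,B)$ measurable for each Borel $B$. $r:S\times A\to\mathbb{R}$ is the measurable payoff and $\beta\in(0,1)$ the discount factor. Strategies: $\sigma=(\sigma_t)_{t\ge1}$ with $\sigma_t:S\times(A\times S)^{t-1}\to A$ Borel measurable and $\sigma_t(s(1),a(1),\dots,s(t))\in\Gamma(s(t))$. With initial state $s(1)=s$, $V_\sigma(s)=\mathbb{E}_\sigma\sum_{t=1}^\infty\beta^{t-1}r(s(t),a(t))$, where $\mathbb{E}_\sigma$ is the expectation for the process generated by $\sigma$ and $p$; the value function is $V(s)=\sup_\sigma V_\sigma(s)$. Standing assumptions: $r$ is bounded and u.s.c. (upper semi-continuous); $p$ is u.s.c., i.e., $(s,a)\mapsto\int f(s')p(s,a,ds')$ is u.s.c. and bounded whenever $f:S\to\mathbb{R}$ is u.s.c. and bounded; $\Gamma$ is u.s.c.,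 i.e., $\{s:\Gamma(s)\subseteq U\}$ is open whenever $U\subseteq A$ is open; $\Gamma(s)$ is nonempty and compact for each $s$. (Under these, $V$ is the unique bounded u.s.c. solution of $V(s)=\max_{a\in\Gamma(s)}[r(s,a)+\beta\int V(s')p(s,a,ds')]$.) Definitions: a lattice in $\mathbb{R}^m$ is a subset closed under componentwise maximum $x\lor y$ and componentwise minimum $x\land y$ (product order). $f:X\to\mathbb{R}$ on a lattice $X$ is supermodular if $f(x)+f(x')\le f(x\lor x')+f(x\land x')$ for all $x,x'\in X$. "$r$ is supermodular" means on the lattice $S\times A$. $p$ is supermodular if $g(s,a)=\int f(s')p(s,a,ds')$ is supermodular on $S\times A$ whenever $f:S\to\mathbb{R}$ is supermodular (measurable, integrals defined). $\Gamma$ is supermodular if $a'\in\Gamma(s')$ and $a''\in\Gamma(s'')$ imply $a'\lor a''\in\Gamma(s'\lor s'')$ and $a'\land a''\in\Gamma(s'\land s'')$. A correspondence $G$ from a partially ordered set into subsets of a lattice is ascending if whenever $s_2\ge s_1$, $x\in G(s_2)$ and $x'\in G(s_1)$, we have $x\lor x'\in G(s_2)$ and $x\land x'\in G(s_1)$ (in particular each $G(s)$ is a sublattice). *)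

theory Defs
  imports "HOL-Probability.Probability"
begin

subsection \<open>Lattices and supermodularity\<close>

text \<open>
  On \<^typ>\<open>real ^ 'n\<close> and on products of such types the library's order, \<open>sup\<close> and \<open>inf\<close> are
  the componentwise ones.
\<close>

definition is_lattice :: "'a::lattice set \<Rightarrow> bool" where
  "is_lattice X \<longleftrightarrow> (\<forall>x\<in>X. \<forall>y\<in>X. sup x y \<in> X \<and> inf x y \<in> X)"

definition supermodular_on :: "'a::lattice set \<Rightarrow> ('a \<Rightarrow> real) \<Rightarrow> bool" where
  "supermodular_on X f \<longleftrightarrow> (\<forall>x\<in>X. \<forall>x'\<in>X. f x + f x' \<le> f (sup x x') + f (inf x x'))"

definition supermodular_corr :: "'s::lattice set \<Rightarrow> ('s \<Rightarrow> 'a::lattice set) \<Rightarrow> bool" where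
  "supermodular_corr S \<Gamma> \<longleftrightarrow>
     (\<forall>s'\<in>S. \<forall>s''\<in>S. \<forall>a'\<in>\<Gamma> s'. \<forall>a''\<in>\<Gamma> s''.
        sup a' a'' \<in> \<Gamma> (sup s' s'') \<and> inf a' a'' \<in> \<Gamma> (inf s' s''))"

definition ascending_on :: "'s::order set \<Rightarrow> ('s \<Rightarrow> 'a::lattice set) \<Rightarrow> bool" where
  "ascending_on S G \<longleftrightarrow>
     (\<forall>s\<^sub>1\<in>S. \<forall>s\<^sub>2\<in>S. s\<^sub>1 \<le> s\<^sub>2 \<longrightarrow>
        (\<forall>x\<in>G s\<^sub>2. \<forall>x'\<in>G s\<^sub>1. sup x x' \<in> G s\<^sub>2 \<and> inf x x' \<in> G s\<^sub>1))"

subsection \<open>Upper semi-continuity\<close>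

definition usc_on :: "'a::topological_space set \<Rightarrow> ('a \<Rightarrow> real) \<Rightarrow> bool" where
  "usc_on X f \<longleftrightarrow> (\<forall>c. openin (top_of_set X) {x \<in> X. f x < c})"

definition usc_corr ::
  "'s::topological_space set \<Rightarrow> 'a::topological_space set \<Rightarrow> ('s \<Rightarrow> 'a set) \<Rightarrow> bool" where
  "usc_corr S A \<Gamma> \<longleftrightarrow>
     (\<forall>U. openin (top_of_set A) U \<longrightarrow> openin (top_of_set S) {s \<in> S. \<Gamma> s \<subseteq> U})"

subsection \<open>Transition probabilities\<close>

abbreviation borel_of_set :: "'a::topological_space set \<Rightarrow> 'a measure" where
  "borel_of_set X \<equiv> restrict_space borel X"

definition transition_prob ::
  "'s::topological_space set \<Rightarrow> 'a::topological_space set \<Rightarrow> ('s \<times> 'a \<Rightarrow> 's measure) \<Rightarrow> bool" where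
  "transition_prob S A p \<longleftrightarrow>
     (\<forall>x\<in>S \<times> A. prob_space (p x) \<and> sets (p x) = sets (borel_of_set S)) \<and>
     (\<forall>B\<in>sets (borel_of_set S).
        (\<lambda>x. measure (p x) B) \<in> borel_measurable (borel_of_set S \<Otimes>\<^sub>M borel_of_set A))"

definition usc_prob ::
  "'s::topological_space set \<Rightarrow> 'a::topological_space set \<Rightarrow> ('s \<times> 'a \<Rightarrow> 's measure) \<Rightarrow> bool" where
  "usc_prob S A p \<longleftrightarrow>
     (\<forall>f. usc_on S f \<and> bounded (f ` S) \<longrightarrow>
        usc_on (S \<times> A) (\<lambda>x. \<integral>s'. f s' \<partial>p x) \<and> bounded ((\<lambda>x. \<integral>s'. f s' \<partial>p x) ` (S \<times> A)))"

definition supermodular_prob ::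
  "('s::{topological_space,lattice}) set \<Rightarrow> ('a::lattice) set \<Rightarrow> ('s \<times> 'a \<Rightarrow> 's measure) \<Rightarrow> bool" where
  "supermodular_prob S A p \<longleftrightarrow>
     (\<forall>f. f \<in> borel_measurable (borel_of_set S) \<and> (\<forall>x\<in>S \<times> A. integrable (p x) f) \<and>
        supermodular_on S f \<longrightarrow> supermodular_on (S \<times> A) (\<lambda>x. \<integral>s'. f s' \<partial>p x))"

subsection \<open>Strategies and the value function\<close>

text \<open>
  Periods are numbered from \<open>0\<close>, so the discount factor of period \<open>t\<close> is \<open>\<beta> ^ t\<close>.  The information
  \<open>(s(0), a(0), s(1), \<dots>, s(t))\<close> available in period \<open>t\<close> is regrouped as a pair \<open>(h, s)\<close>, where
  \<open>h i = (s(i), a(i))\<close> for \<open>i < t\<close> and \<open>s = s(t)\<close>.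
\<close>

definition strategies ::
  "'s::topological_space set \<Rightarrow> 'a::topological_space set \<Rightarrow> ('s \<Rightarrow> 'a set) \<Rightarrow>
     (nat \<Rightarrow> (nat \<Rightarrow> 's \<times> 'a) \<Rightarrow> 's \<Rightarrow> 'a) set" where
  "strategies S A \<Gamma> =
     {\<sigma>. \<forall>t.
        (\<lambda>(h, s). \<sigma> t h s)
          \<in> (\<Pi>\<^sub>M i\<in>{0..<t}. borel_of_set S \<Otimes>\<^sub>M borel_of_set A) \<Otimes>\<^sub>M borel_of_set S
            \<rightarrow>\<^sub>M borel_of_set A \<and>
        (\<forall>h\<in>{0..<t} \<rightarrow>\<^sub>E S \<times> A. \<forall>s\<in>S. \<sigma> t h s \<in> \<Gamma> s)}"

text \<open>The conditional law of \<open>(s(t), a(t))\<close> given the state-action pairs of the earlier periods.\<close>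

definition step_law ::
  "'s::topological_space set \<Rightarrow> 'a::topological_space set \<Rightarrow> ('s \<times> 'a \<Rightarrow> 's measure) \<Rightarrow>
     (nat \<Rightarrow> (nat \<Rightarrow> 's \<times> 'a) \<Rightarrow> 's \<Rightarrow> 'a) \<Rightarrow> 's \<Rightarrow> nat \<Rightarrow> (nat \<Rightarrow> 's \<times> 'a) \<Rightarrow> ('s \<times> 'a) measure" where
  "step_law S A p \<sigma> s\<^sub>0 t h =
     distr (case t of 0 \<Rightarrow> return (borel_of_set S) s\<^sub>0 | Suc i \<Rightarrow> p (h i))
       (borel_of_set S \<Otimes>\<^sub>M borel_of_set A) (\<lambda>s. (s, \<sigma> t h s))"

text \<open>
  The law of the whole process on \<open>(S \<times> A)\<^sup>\<nat>\<close>: the term below is what the notation \<open>PF.lim\<close> of the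
  locale \<^locale>\<open>Ionescu_Tulcea\<close> stands for, i.e. the measure given by the Ionescu-Tulcea theorem.
\<close>

definition process_law ::
  "'s::topological_space set \<Rightarrow> 'a::topological_space set \<Rightarrow> ('s \<times> 'a \<Rightarrow> 's measure) \<Rightarrow>
     (nat \<Rightarrow> (nat \<Rightarrow> 's \<times> 'a) \<Rightarrow> 's \<Rightarrow> 'a) \<Rightarrow> 's \<Rightarrow> (nat \<Rightarrow> 's \<times> 'a) measure" where
  "process_law S A p \<sigma> s\<^sub>0 =
     (let M = (\<lambda>_. borel_of_set S \<Otimes>\<^sub>M borel_of_set A)
      in projective_family.lim UNIV (Ionescu_Tulcea.CI (step_law S A p \<sigma> s\<^sub>0) M) M)"

definition strategy_value ::
  "'s::topological_space set \<Rightarrow> 'a::topological_space set \<Rightarrow> ('s \<times> 'a \<Rightarrow> 's measure) \<Rightarrow>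
     ('s \<times> 'a \<Rightarrow> real) \<Rightarrow> real \<Rightarrow> (nat \<Rightarrow> (nat \<Rightarrow> 's \<times> 'a) \<Rightarrow> 's \<Rightarrow> 'a) \<Rightarrow> 's \<Rightarrow> real" where
  "strategy_value S A p r \<beta> \<sigma> s = (\<integral>\<omega>. (\<Sum>t. \<beta> ^ t * r (\<omega> t)) \<partial>process_law S A p \<sigma> s)"

definition value_function ::
  "'s::topological_space set \<Rightarrow> 'a::topological_space set \<Rightarrow> ('s \<Rightarrow> 'a set) \<Rightarrow>
     ('s \<times> 'a \<Rightarrow> 's measure) \<Rightarrow> ('s \<times> 'a \<Rightarrow> real) \<Rightarrow> real \<Rightarrow> 's \<Rightarrow> real" where
  "value_function S A \<Gamma> p r \<beta> s = (SUP \<sigma>\<in>strategies S A \<Gamma>. strategy_value S A p r \<beta> \<sigma> s)"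

definition optimal_actions ::
  "'s::topological_space set \<Rightarrow> 'a::topological_space set \<Rightarrow> ('s \<Rightarrow> 'a set) \<Rightarrow>
     ('s \<times> 'a \<Rightarrow> 's measure) \<Rightarrow> ('s \<times> 'a \<Rightarrow> real) \<Rightarrow> real \<Rightarrow> 's \<Rightarrow> 'a set" where
  "optimal_actions S A \<Gamma> p r \<beta> s =
     {a. is_arg_max (\<lambda>a. r (s, a) + \<beta> * (\<integral>s'. value_function S A \<Gamma> p r \<beta> s' \<partial>p (s, a)))
           (\<lambda>a. a \<in> \<Gamma> s) a}"

end

theory Submission
  imports Defs
begin

text \<open>
  The Bellman operator preserves the bounded upper semi-continuous supermodular functions and is a
  \<open>\<beta>\<close>-contraction for the supremum norm, so it has a fixed point \<open>W\<close> among them.  The maximizers of the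
  Bellman equation for \<open>W\<close> then form an ascending correspondence, by adding up the supermodularity
  inequality for the action values and the optimality of the two given actions.

  It remains to see that \<open>W\<close> is the value function.  Telescoping \<open>\<beta>\<^sup>t W(s(t))\<close> along the process shows
  that every strategy earns at most \<open>W\<close>, with equality if it always uses maximizers.  Supermodularity
  also replaces a general measurable selection theorem: each set of maximizers is a compact
  sublattice, and its greatest element depends measurably on the state.
\<close>

subsection \<open>Upper semi-continuous functions and correspondences\<close>

lemma openin_measurable:
  assumes "openin (top_of_set X) U"
  shows "U \<in> sets (borel_of_set X)"
proof -
  obtain T where T: "open T" "U = X \<inter> T" using assms unfolding openin_open by blast
  show ?thesis
    unfolding sets_restrict_space T(2) using borel_open[OF T(1)] by (rule imageI)
qed

lemma usc_on_borel_measurable: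
  assumes "usc_on X f"
  shows "f \<in> borel_measurable (borel_of_set X)"
  using assms by (auto simp: borel_measurable_iff_less usc_on_def space_restrict_space intro: openin_measurable)

lemma usc_on_compose:
  assumes f: "usc_on Y f" and h: "continuous_on X h" "h \<in> X \<rightarrow> Y"
  shows "usc_on X (\<lambda>x. f (h x))"
  unfolding usc_on_def
proof
  fix c
  have "X \<inter> h -` {y \<in> Y. f y < c} = {x \<in> X. f (h x) < c}"
    using h(2) by auto
  then show "openin (top_of_set X) {x \<in> X. f (h x) < c}"
    using continuous_openin_preimage[OF h, of "{y \<in> Y. f y < c}"] f by (simp add: usc_on_def)
qed

lemma usc_on_subset: "usc_on Y f \<Longrightarrow> X \<subseteq> Y \<Longrightarrow> usc_on X f"
  using usc_on_compose[of Y f X "\<lambda>x. x"] by auto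

lemma usc_on_add:
  assumes f: "usc_on X f" and g: "usc_on X g"
  shows "usc_on X (\<lambda>x. f x + g x)"
  unfolding usc_on_def
proof
  fix c
  have "{x \<in> X. f x + g x < c} = (\<Union>q\<in>\<rat>. {x \<in> X. f x < q} \<inter> {x \<in> X. g x < c - q})"
  proof safe
    fix x assume "x \<in> X" "f x + g x < c"
    moreover obtain q where "q \<in> \<rat>" "f x < q" "q < c - g x"
      using Rats_dense_in_real[of "f x" "c - g x"] \<open>f x + g x < c\<close> by auto
    ultimately show "x \<in> (\<Union>q\<in>\<rat>. {x \<in> X. f x < q} \<inter> {x \<in> X. g x < c - q})"
      by (intro UN_I[of q]) auto
  qed auto
  also have "openin (top_of_set X) \<dots>"
    using f g by (intro openin_Union) (auto simp: usc_on_def)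
  finally show "openin (top_of_set X) {x \<in> X. f x + g x < c}" .
qed

lemma usc_on_cmult:
  assumes f: "usc_on X f" and b: "0 < b"
  shows "usc_on X (\<lambda>x. b * f x)"
proof -
  have "{x \<in> X. b * f x < c} = {x \<in> X. f x < c / b}" for c
    using b by (auto simp: field_simps)
  with f show ?thesis by (simp add: usc_on_def)
qed

lemma usc_on_uniform_limit:
  assumes f: "\<And>n. usc_on X (f n)" and lim: "uniform_limit X f g sequentially"
  shows "usc_on X g"
  unfolding usc_on_def
proof
  fix c
  show "openin (top_of_set X) {x \<in> X. g x < c}"
    unfolding openin_subopen[of _ "{x \<in> X. g x < c}"]
  proof
    fix x assume "x \<in> {x \<in> X. g x < c}"
    then have x: "x \<in> X" "g x < c" by auto
    \<comment> \<open>A third of the gap at \<open>x\<close>: then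
      \<open>f n x < g x + e < c - e\<close> puts \<open>x\<close> into \<open>?T\<close>, and on
      \<open>?T\<close> the approximation error \<open>e\<close> still leaves \<open>g\<close> below
      \<open>c\<close>.\<close>
    define e where "e = (c - g x) / 3"
    have "0 < e" using x by (simp add: e_def)
    then obtain n where n: "\<And>y. y \<in> X \<Longrightarrow> dist (f n y) (g y) < e"
      using uniform_limitD[OF lim \<open>0 < e\<close>] by (auto simp: eventually_sequentially)
    let ?T = "{y \<in> X. f n y < c - e}"
    have "openin (top_of_set X) ?T" using f by (simp add: usc_on_def)
    moreover have "x \<in> ?T"
    proof -
      have "c - g x = 3 * e" by (simp add: e_def)
      then show ?thesis using n[OF x(1)] x(1) \<open>0 < e\<close> by (simp add: dist_real_def)
    qed
    moreover have "?T \<subseteq> {y \<in> X. g y < c}"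
    proof
      fix y assume "y \<in> ?T"
      then show "y \<in> {y \<in> X. g y < c}" using n[of y] by (simp add: dist_real_def) linarith
    qed
    ultimately show "\<exists>T. openin (top_of_set X) T \<and> x \<in> T \<and> T \<subseteq> {x \<in> X. g x < c}" by blast
  qed
qed

text \<open>If no maximum existed, the relatively open sets \<open>{y \<in> K. f y < f x}\<close>
  would cover \<open>K\<close>. Among the finitely many \<open>x\<close> of a subcover, one with the
  largest \<open>f x\<close> lies in no member of it.\<close>

lemma usc_on_attains_max:
  assumes K: "compact K" "K \<noteq> {}" and f: "usc_on K f"
  obtains x where "x \<in> K" "\<And>y. y \<in> K \<Longrightarrow> f y \<le> f x"
proof -
  have "\<exists>x\<in>K. \<forall>y\<in>K. f y \<le> f x"
  proof (rule ccontr)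
    assume contra: "\<not> ?thesis"
    let ?C = "(\<lambda>x. {y \<in> K. f y < f x}) ` K"
    have "\<forall>c\<in>?C. openin (top_of_set K) c" using f by (auto simp: usc_on_def)
    moreover have "K \<subseteq> \<Union>?C" using contra by (force simp: not_le)
    ultimately have "(\<forall>c\<in>?C. openin (top_of_set K) c) \<and> K \<subseteq> \<Union>?C" by (rule conjI)
    then have "\<exists>D\<subseteq>?C. finite D \<and> K \<subseteq> \<Union>D"
      by (rule compact_eq_openin_cover[THEN iffD1, OF K(1), THEN spec, THEN mp])
    then obtain D where D: "D \<subseteq> ?C" "finite D" "K \<subseteq> \<Union>D" by auto
    then obtain F where F: "F \<subseteq> K" "finite F" "D = (\<lambda>x. {y \<in> K. f y < f x}) ` F"
      by (meson finite_subset_image)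
    with D K have "F \<noteq> {}" by auto
    with F(2) have "Max (f ` F) \<in> f ` F" by (intro Max_in) auto
    then obtain x where x: "x \<in> F" "f x = Max (f ` F)" by auto
    then have "f y \<le> f x" if "y \<in> F" for y using F(2) that by simp
    moreover obtain y where "y \<in> F" "f x < f y" using x(1) F D(3) by auto
    ultimately show False by force
  qed
  with that show thesis by blast
qed

lemma usc_on_compact_superlevel:
  assumes "compact K" "usc_on K f"
  shows "compact {x \<in> K. c \<le> f x}"
proof -
  have "{x \<in> K. c \<le> f x} = K - {x \<in> K. f x < c}" by auto
  moreover have "closedin (top_of_set K) (K - {x \<in> K. f x < c})"
    using assms(2) by (simp add: usc_on_def closedin_diff)
  ultimately show ?thesis using closedin_compact[OF assms(1)] by simp
qed

text \<open>
  The set is open because the bound on the compact slice above \<open>s\<close> persists, by the tube lemma, on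
  a product neighbourhood, and upper semi-continuity of \<open>\<Gamma>\<close> keeps the nearby slices inside it.
\<close>

lemma openin_bound_on_fibres:
  fixes S :: "'s::topological_space set" and A :: "'a::topological_space set"
  assumes g: "usc_on (S \<times> A) g" and \<Gamma>: "usc_corr S A \<Gamma>"
    and \<Gamma>S: "\<And>s. s \<in> S \<Longrightarrow> \<Gamma> s \<subseteq> A \<and> compact (\<Gamma> s)" and C: "closed C"
  shows "openin (top_of_set S) {s \<in> S. \<forall>a\<in>\<Gamma> s \<inter> C. g (s, a) < c}" (is "openin _ ?E")
  unfolding openin_subopen[of _ ?E]
proof
  fix s assume "s \<in> ?E"
  then have s: "s \<in> S" "\<And>a. a \<in> \<Gamma> s \<Longrightarrow> a \<in> C \<Longrightarrow> g (s, a) < c" by auto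
  obtain W where W: "open W" "{x \<in> S \<times> A. g x < c} = (S \<times> A) \<inter> W"
    using g unfolding usc_on_def openin_open by metis
  \<comment> \<open>Adjoining the complement of \<open>C\<close> makes actions outside
    \<open>C\<close> harmless, so that the whole compact slice \<open>\<Gamma> s\<close> can be
    covered by product neighbourhoods.\<close>
  have "open (W \<union> UNIV \<times> - C)" using W C by (intro open_Un open_Times) auto
  moreover have "(s, a) \<in> W \<union> UNIV \<times> - C" if "a \<in> \<Gamma> s" for a
    using s that W(2) \<Gamma>S[OF s(1)] by auto
  ultimately have "\<forall>a\<in>\<Gamma> s. \<exists>N U. open N \<and> open U \<and> s \<in> N \<and> a \<in> U \<and> N \<times> U \<subseteq> W \<union> UNIV \<times> - C"
    by (metis open_prod_elim mem_Sigma_iff)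
  then obtain N U where NU: "\<And>a. a \<in> \<Gamma> s \<Longrightarrow> open (N a) \<and> open (U a) \<and> s \<in> N a \<and> a \<in> U a \<and>
      N a \<times> U a \<subseteq> W \<union> UNIV \<times> - C" by metis
  obtain F where F: "F \<subseteq> \<Gamma> s" "finite F" "\<Gamma> s \<subseteq> (\<Union>a\<in>F. U a)"
    by (rule compactE_image[of "\<Gamma> s" "\<Gamma> s" U]) (use NU \<Gamma>S[OF s(1)] in blast)+
  define N' where "N' = (\<Inter>a\<in>F. N a)"
  define U' where "U' = (\<Union>a\<in>F. U a)"
  have "open N'" "open U'" using F NU unfolding N'_def U'_def by blast+
  let ?T = "(S \<inter> N') \<inter> {s \<in> S. \<Gamma> s \<subseteq> A \<inter> U'}"
  have "openin (top_of_set A) (A \<inter> U')" using \<open>open U'\<close> by (simp add: openin_open_Int)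
  then have "openin (top_of_set S) ?T"
    using \<Gamma> \<open>open N'\<close> by (intro openin_Int openin_open_Int) (auto simp: usc_corr_def)
  moreover have "s \<in> ?T" using s F NU \<Gamma>S[OF s(1)] by (auto simp: N'_def U'_def)
  moreover have "?T \<subseteq> ?E"
  proof safe
    fix t a assume t: "t \<in> S" "t \<in> N'" "\<Gamma> t \<subseteq> A \<inter> U'" and a: "a \<in> \<Gamma> t" "a \<in> C"
    then obtain b where "b \<in> F" "a \<in> U b" by (auto simp: U'_def)
    then have "(t, a) \<in> W" using NU[of b] F t a by (fastforce simp: N'_def)
    then show "g (t, a) < c" using W(2) t a by blast
  qed
  ultimately show "\<exists>T. openin (top_of_set S) T \<and> s \<in> T \<and> T \<subseteq> ?E" by blast
qed

text \<open>A maximizer of \<open>x \<mapsto> \<Sum>\<^sub>i x\<^sub>i\<close> is greatest: joining it with another point cannot increase the sum.\<close>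

lemma compact_lattice_has_greatest:
  fixes K :: "'a::ordered_euclidean_space set"
  assumes K: "compact K" "K \<noteq> {}" "is_lattice K"
  obtains m where "m \<in> K" "\<And>x. x \<in> K \<Longrightarrow> x \<le> m"
proof -
  have "continuous_on K (\<lambda>x. x \<bullet> One)" by (intro continuous_intros)
  then obtain m where m: "m \<in> K" "\<And>x. x \<in> K \<Longrightarrow> x \<bullet> One \<le> m \<bullet> One"
    using continuous_attains_sup[OF K(1,2)] by metis
  show thesis
  proof (rule that[OF m(1)])
    fix x assume "x \<in> K"
    then have "sup x m \<in> K" using K(3) m(1) by (auto simp: is_lattice_def)
    then have "(\<Sum>b\<in>Basis. (sup x m - m) \<bullet> b) \<le> 0"
      using m(2) by (simp add: inner_sum_right inner_diff_left sum_subtractf)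
    moreover have nonneg: "\<forall>b\<in>Basis. 0 \<le> (sup x m - m) \<bullet> b"
      using eucl_le[of m "sup x m"] by (simp add: inner_diff_left)
    ultimately have "\<forall>b\<in>Basis. (sup x m - m) \<bullet> b = 0"
      using sum_nonneg_eq_0_iff[of Basis "\<lambda>b. (sup x m - m) \<bullet> b"]
      by (simp add: antisym sum_nonneg)
    then have "sup x m = m" by (simp add: euclidean_eq_iff[of "sup x m"] inner_diff_left)
    then show "x \<le> m" by (metis sup_ge1)
  qed
qed

subsection \<open>Expectations under the Ionescu-Tulcea measure\<close>

text \<open>A pointwise sign suffices, since the Bochner integral takes the default value 0 on
  non-integrable functions.\<close>

lemma integral_nonpos:
  fixes f :: "'a \<Rightarrow> real"
  assumes "\<And>x. x \<in> space M \<Longrightarrow> f x \<le> 0"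
  shows "(\<integral>x. f x \<partial>M) \<le> 0"
  using Bochner_Integration.integral_nonneg[of M "\<lambda>x. - f x"] assms by simp

context Ionescu_Tulcea
begin

text \<open>\<open>C 0 n\<close> composes the first \<open>n\<close> kernels, starting from the
  empty history, whose only representative is \<open>\<lambda>_. undefined\<close>. Restricting the
  result to the coordinates below \<open>n\<close> changes nothing.\<close>

lemma CI_initial_segment: "CI {0..<n} = C 0 n (\<lambda>_. undefined)"
proof -
  have "up_to {0..<n} = n"
    using up_to_less[of "{0..<n}" "up_to {0..<n}"] by (intro antisym) (force simp: up_to_iff)+
  then show ?thesis
    using distr_C[of n n "\<lambda>_. undefined" 0] by (simp add: CI_def)
qed

text \<open>The bridge between the infinite process and finite histories: the limit measure has the
  composed kernels as its marginals.\<close>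

lemma integral_lim_initial_segment:
  assumes F: "F \<in> borel_measurable (PiM {0..<n} M)"
  shows "(\<integral>\<omega>. F (restrict \<omega> {0..<n}) \<partial>PF.lim) = (\<integral>h. (F h :: real) \<partial>C 0 n (\<lambda>_. undefined))"
proof -
  have "(\<lambda>\<omega>. restrict \<omega> {0..<n}) \<in> PF.lim \<rightarrow>\<^sub>M PiM {0..<n} M"
    by (subst measurable_cong_sets[OF PF.sets_lim refl]) (auto intro: measurable_restrict_subset)
  from integral_distr[OF this F] show ?thesis
    using distr_lim[of "{0..<n}"] by (simp add: CI_initial_segment)
qed

text \<open>Conditioning on the first \<open>n\<close> coordinates. On finite histories the last
  kernel splits off as a \<open>bind\<close>, for whose integral formula \<open>B\<close> supplies
  the bound; the outer integral is then carried back to the limit measure.\<close>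

lemma integral_lim_Suc:
  fixes F :: "(nat \<Rightarrow> 'a) \<Rightarrow> real"
  assumes F[measurable]: "F \<in> borel_measurable (PiM {0..<Suc n} M)"
    and B: "\<And>h. h \<in> space (PiM {0..<Suc n} M) \<Longrightarrow> \<bar>F h\<bar> \<le> B"
  shows "(\<integral>\<omega>. F (restrict \<omega> {0..<Suc n}) \<partial>PF.lim) =
    (\<integral>\<omega>. (\<integral>y. F ((restrict \<omega> {0..<n})(n := y)) \<partial>P n (restrict \<omega> {0..<n})) \<partial>PF.lim)"
proof -
  let ?C = "C 0 n (\<lambda>_. undefined)"
  interpret C: prob_space ?C by (rule prob_space_C) (simp add: space_PiM)
  have sets_C': "sets ?C = sets (PiM {0..<n} M)" and space_C': "space ?C = space (PiM {0..<n} M)"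
    using sets_C[of "\<lambda>_. undefined" 0 n] space_C[of "\<lambda>_. undefined" 0 n] by (simp_all add: space_PiM)
  have eP: "eP n \<in> ?C \<rightarrow>\<^sub>M subprob_algebra (PiM {0..<Suc n} M)"
    by (subst measurable_cong_sets[OF sets_C' refl]) (rule measurable_eP)
  \<comment> \<open>\<open>eP n h\<close> is the image of \<open>P n h\<close> under appending the
    new value as coordinate \<open>n\<close>.\<close>
  have F_eP: "(\<integral>h'. F h' \<partial>eP n h) = (\<integral>y. F (h(n := y)) \<partial>P n h)" if h: "h \<in> space (PiM {0..<n} M)" for h
    unfolding eP_def using h by (intro integral_distr measurable_fun_upd[where J="{0..<n}"]) auto
  have "(\<integral>\<omega>. F (restrict \<omega> {0..<Suc n}) \<partial>PF.lim) = (\<integral>h. F h \<partial>(?C \<bind> eP n))"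
    by (simp add: integral_lim_initial_segment[OF F])
  also have "\<dots> = (\<integral>h. (\<integral>h'. F h' \<partial>eP n h) \<partial>?C)"
    using B C.finite_measure_axioms prob_space_eP
    by (intro integral_bind[where K="PiM {0..<Suc n} M" and B=B and B'=1] eP F C.finite_measure AE_I2)
       (auto simp: space_C' prob_space.emeasure_space_1)
  also have "\<dots> = (\<integral>\<omega>. (\<integral>h'. F h' \<partial>eP n (restrict \<omega> {0..<n})) \<partial>PF.lim)"
    by (rule integral_lim_initial_segment[symmetric]) measurable
  also have "\<dots> = (\<integral>\<omega>. (\<integral>y. F ((restrict \<omega> {0..<n})(n := y)) \<partial>P n (restrict \<omega> {0..<n})) \<partial>PF.lim)"
    by (intro Bochner_Integration.integral_cong F_eP) (auto simp: space_PiM PiE_iff)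
  finally show ?thesis .
qed

lemma prob_space_lim: "prob_space PF.lim"
proof
  \<comment> \<open>The whole space is the cylinder over the empty index set, whose measure is known
    from the projective family.\<close>
  have "space PF.lim = PF.emb UNIV {} (space (PiM {} M))"
    by (auto simp: prod_emb_def space_PiM)
  then show "emeasure PF.lim (space PF.lim) = 1"
    using lim[of "{}" "space (PiM {} M)"] prob_space.emeasure_space_1[OF PF.prob_space_P[of "{}"]]
    by (simp add: PF.space_P)
qed

end

section \<open>The process generated by a strategy\<close>

locale controlled_process =
  fixes S :: "'s::topological_space set" and A :: "'a::topological_space set"
    and \<Gamma> :: "'s \<Rightarrow> 'a set" and p :: "'s \<times> 'a \<Rightarrow> 's measure"
    and \<sigma> :: "nat \<Rightarrow> (nat \<Rightarrow> 's \<times> 'a) \<Rightarrow> 's \<Rightarrow> 'a" and s\<^sub>0 :: 's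
  assumes p: "transition_prob S A p"
    and \<sigma>: "\<sigma> \<in> strategies S A \<Gamma>" and s\<^sub>0: "s\<^sub>0 \<in> S"
begin

abbreviation (input) "N \<equiv> borel_of_set S \<Otimes>\<^sub>M borel_of_set A"

abbreviation (input) "next_state t h \<equiv> (case t of 0 \<Rightarrow> return (borel_of_set S) s\<^sub>0 | Suc i \<Rightarrow> p (h i))"

lemma space_N: "space N = S \<times> A"
  by (simp add: space_pair_measure space_restrict_space)

text \<open>Setwise measurability of the real numbers \<open>measure (p x) B\<close> becomes
  measurability of the kernel, because each \<open>p x\<close> is finite.\<close>

lemma measurable_p: "p \<in> N \<rightarrow>\<^sub>M subprob_algebra (borel_of_set S)"
proof (rule measurable_subprob_algebra)
  fix x assume "x \<in> space N"
  then have "prob_space (p x)" "sets (p x) = sets (borel_of_set S)"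
    using p by (auto simp: transition_prob_def space_N)
  then show "subprob_space (p x)" "sets (p x) = sets (borel_of_set S)"
    by (auto intro: prob_space_imp_subprob_space)
next
  fix B assume "B \<in> sets (borel_of_set S)"
  then have "(\<lambda>x. ennreal (measure (p x) B)) \<in> borel_measurable N"
    using p by (auto simp: transition_prob_def)
  moreover have "emeasure (p x) B = ennreal (measure (p x) B)" if "x \<in> space N" for x
    using p that by (auto simp: transition_prob_def space_N
      intro!: finite_measure.emeasure_eq_measure prob_space.finite_measure)
  ultimately show "(\<lambda>x. emeasure (p x) B) \<in> borel_measurable N"
    by (simp cong: measurable_cong)
qed

lemma measurable_strategy:
  "(\<lambda>(h, s). \<sigma> t h s) \<in> (PiM {0..<t} (\<lambda>_. N)) \<Otimes>\<^sub>M borel_of_set S \<rightarrow>\<^sub>M borel_of_set A"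
  using \<sigma> by (auto simp: strategies_def)

lemma strategy_feasible:
  "h \<in> space (PiM {0..<t} (\<lambda>_. N)) \<Longrightarrow> s \<in> S \<Longrightarrow> \<sigma> t h s \<in> \<Gamma> s"
  using \<sigma> by (auto simp: strategies_def space_PiM space_N)

lemma measurable_next_state:
  "next_state t \<in> PiM {0..<t} (\<lambda>_. N) \<rightarrow>\<^sub>M subprob_algebra (borel_of_set S)"
proof (cases t)
  case 0
  then show ?thesis
    using s\<^sub>0 by (auto simp: space_subprob_algebra space_restrict_space
      intro!: measurable_const prob_space_imp_subprob_space prob_space_return)
next
  case (Suc i)
  have "(\<lambda>h. h i) \<in> PiM {0..<t} (\<lambda>_. N) \<rightarrow>\<^sub>M N"
    using Suc by (intro measurable_component_singleton) auto
  from measurable_compose[OF this measurable_p] Suc show ?thesis by simp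
qed

lemma next_state_space:
  assumes "h \<in> space (PiM {0..<t} (\<lambda>_. N))"
  shows "prob_space (next_state t h)" "sets (next_state t h) = sets (borel_of_set S)"
    "space (next_state t h) = S"
proof -
  have hi: "h i \<in> S \<times> A" if "t = Suc i" for i
    using assms that by (auto simp: space_PiM PiE_iff space_N)
  show "prob_space (next_state t h)"
    using hi p s\<^sub>0 by (cases t) (auto simp: transition_prob_def space_restrict_space intro: prob_space_return)
  show sets: "sets (next_state t h) = sets (borel_of_set S)"
    using hi p by (cases t) (auto simp: transition_prob_def)
  show "space (next_state t h) = S"
    using sets_eq_imp_space_eq[OF sets] by (simp add: space_restrict_space)
qed

lemma measurable_choice:
  assumes "h \<in> space (PiM {0..<t} (\<lambda>_. N))"
  shows "(\<lambda>s. (s, \<sigma> t h s)) \<in> next_state t h \<rightarrow>\<^sub>M N"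
proof -
  have "(\<lambda>s. (s, \<sigma> t h s)) \<in> borel_of_set S \<rightarrow>\<^sub>M N"
    using measurable_compose[OF measurable_Pair1'[OF assms, of "borel_of_set S"] measurable_strategy[of t]]
    by (intro measurable_Pair) auto
  then show ?thesis
    by (subst measurable_cong_sets[OF next_state_space(2)[OF assms] refl])
qed

text \<open>Once the step laws are known to be probability kernels, the raw term in
  \<open>process_law\<close> is the measure provided by the Ionescu-Tulcea theorem.\<close>

interpretation IT: Ionescu_Tulcea "step_law S A p \<sigma> s\<^sub>0" "\<lambda>_. N"
proof (rule Ionescu_Tulcea.intro)
  show "step_law S A p \<sigma> s\<^sub>0 t \<in> PiM {0..<t} (\<lambda>_. N) \<rightarrow>\<^sub>M subprob_algebra N" for t
  proof -
    have "(\<lambda>(h, s). (s, \<sigma> t h s)) \<in> (PiM {0..<t} (\<lambda>_. N)) \<Otimes>\<^sub>M borel_of_set S \<rightarrow>\<^sub>M N"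
      using measurable_strategy[of t] by (auto simp: split_beta' intro!: measurable_Pair)
    then show ?thesis
      unfolding step_law_def by (intro measurable_distr2[OF _ measurable_next_state]) (simp add: split_beta')
  qed
  show "prob_space (step_law S A p \<sigma> s\<^sub>0 t h)" if h: "h \<in> space (PiM {0..<t} (\<lambda>_. N))" for t h
    unfolding step_law_def
    by (intro prob_space.prob_space_distr next_state_space(1) measurable_choice h)
qed

lemma process_law_eq: "process_law S A p \<sigma> s\<^sub>0 = IT.PF.lim"
  by (simp add: process_law_def Let_def)

lemma prob_space_process_law: "prob_space (process_law S A p \<sigma> s\<^sub>0)"
  unfolding process_law_eq by (rule IT.prob_space_lim)

lemma sets_process_law: "sets (process_law S A p \<sigma> s\<^sub>0) = sets (PiM UNIV (\<lambda>_. N))"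
  unfolding process_law_eq by (rule IT.PF.sets_lim)

lemma space_process_law: "space (process_law S A p \<sigma> s\<^sub>0) = UNIV \<rightarrow>\<^sub>E S \<times> A"
  unfolding process_law_eq IT.PF.space_lim by (simp add: space_PiM space_N)

lemma measurable_process_component: "(\<lambda>\<omega>. \<omega> t) \<in> process_law S A p \<sigma> s\<^sub>0 \<rightarrow>\<^sub>M N"
  by (subst measurable_cong_sets[OF sets_process_law refl]) (auto intro: measurable_component_singleton)

lemma integrable_process_component:
  fixes f :: "'s \<times> 'a \<Rightarrow> real"
  assumes f: "f \<in> borel_measurable N" and B: "\<And>x. x \<in> S \<times> A \<Longrightarrow> \<bar>f x\<bar> \<le> B"
  shows "integrable (process_law S A p \<sigma> s\<^sub>0) (\<lambda>\<omega>. f (\<omega> t))"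
proof -
  interpret prob_space "process_law S A p \<sigma> s\<^sub>0" by (rule prob_space_process_law)
  show ?thesis
    using B
    by (intro integrable_const_bound[of _ B] AE_I2 measurable_compose[OF measurable_process_component f])
      (metis PiE_mem UNIV_I real_norm_def space_process_law)
qed

text \<open>Given the history, the state is drawn from \<open>next_state\<close> and the action is a
  function of it. The restriction stays in the argument of \<open>\<sigma>\<close>, whose
  feasibility is known for genuine histories; it disappears from \<open>next_state t\<close>, which
  reads period \<open>t - 1\<close> only.\<close>

lemma integral_process_component:
  fixes f :: "'s \<times> 'a \<Rightarrow> real"
  assumes f: "f \<in> borel_measurable N" and B: "\<And>x. x \<in> S \<times> A \<Longrightarrow> \<bar>f x\<bar> \<le> B"
  shows "(\<integral>\<omega>. f (\<omega> t) \<partial>process_law S A p \<sigma> s\<^sub>0) =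
    (\<integral>\<omega>. (\<integral>s. f (s, \<sigma> t (restrict \<omega> {0..<t}) s) \<partial>next_state t \<omega>) \<partial>process_law S A p \<sigma> s\<^sub>0)"
proof -
  have "(\<lambda>h. h t) \<in> PiM {0..<Suc t} (\<lambda>_. N) \<rightarrow>\<^sub>M N" by (rule measurable_component_singleton) auto
  then have "(\<lambda>h. f (h t)) \<in> borel_measurable (PiM {0..<Suc t} (\<lambda>_. N))"
    using f by (rule measurable_compose)
  from IT.integral_lim_Suc[OF this, of B]
  have "(\<integral>\<omega>. f (\<omega> t) \<partial>process_law S A p \<sigma> s\<^sub>0) =
      (\<integral>\<omega>. (\<integral>y. f y \<partial>step_law S A p \<sigma> s\<^sub>0 t (restrict \<omega> {0..<t})) \<partial>process_law S A p \<sigma> s\<^sub>0)"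
    using B by (simp add: process_law_eq space_PiM PiE_iff space_N)
  also have "\<dots> = (\<integral>\<omega>. (\<integral>s. f (s, \<sigma> t (restrict \<omega> {0..<t}) s) \<partial>next_state t \<omega>) \<partial>process_law S A p \<sigma> s\<^sub>0)"
  proof (intro Bochner_Integration.integral_cong refl)
    fix \<omega> assume "\<omega> \<in> space (process_law S A p \<sigma> s\<^sub>0)"
    then have "restrict \<omega> {0..<t} \<in> space (PiM {0..<t} (\<lambda>_. N))"
      by (auto simp: space_process_law space_PiM PiE_iff space_N)
    from integral_distr[OF measurable_choice[OF this] f]
    show "(\<integral>y. f y \<partial>step_law S A p \<sigma> s\<^sub>0 t (restrict \<omega> {0..<t})) =
        (\<integral>s. f (s, \<sigma> t (restrict \<omega> {0..<t}) s) \<partial>next_state t \<omega>)"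
      unfolding step_law_def by (cases t) simp_all
  qed
  finally show ?thesis .
qed

end

subsection \<open>The Bellman equation\<close>

text \<open>The class \<open>ordered_euclidean_space\<close> gives actions coordinates, through
  which greatest maximizers are found and shown to be measurable.\<close>

locale discounted_program =
  fixes S :: "'s::{topological_space,lattice} set" and A :: "'a::ordered_euclidean_space set"
    and \<Gamma> :: "'s \<Rightarrow> 'a set" and p :: "'s \<times> 'a \<Rightarrow> 's measure"
    and r :: "'s \<times> 'a \<Rightarrow> real" and \<beta> :: real
  assumes \<beta>_pos: "0 < \<beta>" and \<beta>_less_1: "\<beta> < 1"
    and p: "transition_prob S A p"
    and r_measurable: "r \<in> borel_measurable (borel_of_set S \<Otimes>\<^sub>M borel_of_set A)"
    and r_bounded: "bounded (r ` (S \<times> A))" and r_usc: "usc_on (S \<times> A) r"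
    and p_usc: "usc_prob S A p"
    and \<Gamma>: "\<And>s. s \<in> S \<Longrightarrow> \<Gamma> s \<subseteq> A \<and> \<Gamma> s \<noteq> {} \<and> compact (\<Gamma> s)"
    and \<Gamma>_usc: "usc_corr S A \<Gamma>"
    and S_lattice: "is_lattice S"
    and r_supermodular: "supermodular_on (S \<times> A) r"
    and p_supermodular: "supermodular_prob S A p"
    and \<Gamma>_supermodular: "supermodular_corr S \<Gamma>"
begin

definition action_value :: "('s \<Rightarrow> real) \<Rightarrow> 's \<times> 'a \<Rightarrow> real" where
  "action_value f x = r x + \<beta> * (\<integral>s'. f s' \<partial>p x)"

definition bellman :: "('s \<Rightarrow> real) \<Rightarrow> 's \<Rightarrow> real" where
  "bellman f s = (SUP a\<in>\<Gamma> s. action_value f (s, a))"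

text \<open>Written as a superlevel set, so that compactness is an instance of
  \<open>usc_on_compact_superlevel\<close>. For admissible \<open>f\<close> and
  \<open>s \<in> S\<close>, the inequality is an equality by \<open>bellman_upper\<close>.\<close>

definition maximizers :: "('s \<Rightarrow> real) \<Rightarrow> 's \<Rightarrow> 'a set" where
  "maximizers f s = {a \<in> \<Gamma> s. bellman f s \<le> action_value f (s, a)}"

text \<open>The class in which value iteration takes place: it is closed under
  \<open>bellman\<close> and under uniform limits.\<close>

definition admissible :: "('s \<Rightarrow> real) \<Rightarrow> bool" where
  "admissible f \<longleftrightarrow> usc_on S f \<and> bounded (f ` S) \<and> supermodular_on S f"

lemma admissible_measurable: "admissible f \<Longrightarrow> f \<in> borel_measurable (borel_of_set S)"
  by (simp add: admissible_def usc_on_borel_measurable)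

lemma p_prob_space: "x \<in> S \<times> A \<Longrightarrow> prob_space (p x)"
  and p_sets: "x \<in> S \<times> A \<Longrightarrow> sets (p x) = sets (borel_of_set S)"
  and p_space: "x \<in> S \<times> A \<Longrightarrow> space (p x) = S"
proof -
  assume x: "x \<in> S \<times> A"
  show "prob_space (p x)" and sets: "sets (p x) = sets (borel_of_set S)"
    using p x by (auto simp: transition_prob_def)
  show "space (p x) = S"
    using sets_eq_imp_space_eq[OF sets] by (simp add: space_restrict_space)
qed

lemma admissible_integrable:
  assumes f: "admissible f" and x: "x \<in> S \<times> A"
  shows "integrable (p x) f"
proof -
  interpret prob_space "p x" using x by (rule p_prob_space)
  obtain B where "\<And>s. s \<in> S \<Longrightarrow> norm (f s) \<le> B"
    using f by (auto simp: admissible_def bounded_iff)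
  then show ?thesis
    using admissible_measurable[OF f]
    by (intro integrable_const_bound[of _ B] AE_I2) (simp_all add: p_space[OF x] measurable_cong_sets[OF p_sets[OF x] refl])
qed

lemma action_value_usc: "admissible f \<Longrightarrow> usc_on (S \<times> A) (action_value f)"
  using p_usc unfolding action_value_def
  by (intro usc_on_add usc_on_cmult r_usc \<beta>_pos) (auto simp: admissible_def usc_prob_def)

lemma integral_p_bounded:
  assumes "admissible f"
  obtains B where "\<And>x. x \<in> S \<times> A \<Longrightarrow> \<bar>\<integral>s'. f s' \<partial>p x\<bar> \<le> B"
proof -
  have "bounded ((\<lambda>x. \<integral>s'. f s' \<partial>p x) ` (S \<times> A))"
    using p_usc assms by (auto simp: admissible_def usc_prob_def)
  then show thesis using that by (auto simp: bounded_iff)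
qed

lemma action_value_bounded:
  assumes f: "admissible f"
  obtains B where "\<And>x. x \<in> S \<times> A \<Longrightarrow> \<bar>action_value f x\<bar> \<le> B"
proof -
  obtain B where B: "\<And>x. x \<in> S \<times> A \<Longrightarrow> \<bar>\<integral>s'. f s' \<partial>p x\<bar> \<le> B"
    using f by (rule integral_p_bounded) blast
  obtain R where R: "\<And>x. x \<in> S \<times> A \<Longrightarrow> \<bar>r x\<bar> \<le> R"
    using r_bounded by (auto simp: bounded_iff)
  have "\<bar>action_value f x\<bar> \<le> R + \<beta> * B" if "x \<in> S \<times> A" for x
  proof -
    have "\<bar>\<beta> * (\<integral>s'. f s' \<partial>p x)\<bar> \<le> \<beta> * B"
      using B[OF that] \<beta>_pos by (simp add: abs_mult)
    with R[OF that] show ?thesis unfolding action_value_def by linarith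
  qed
  then show thesis by (rule that)
qed

lemma action_value_supermodular:
  assumes "admissible f"
  shows "supermodular_on (S \<times> A) (action_value f)"
proof -
  have p: "supermodular_on (S \<times> A) (\<lambda>x. \<integral>s'. f s' \<partial>p x)"
    using p_supermodular assms admissible_measurable[OF assms] admissible_integrable[OF assms]
    by (auto simp: supermodular_prob_def admissible_def)
  show ?thesis
    unfolding supermodular_on_def action_value_def
  proof (intro ballI)
    fix x y assume xy: "x \<in> S \<times> A" "y \<in> S \<times> A"
    let ?I = "\<lambda>x. \<integral>s'. f s' \<partial>p x"
    have "\<beta> * (?I x + ?I y) \<le> \<beta> * (?I (sup x y) + ?I (inf x y))"
      using p xy \<beta>_pos unfolding supermodular_on_def by (intro mult_left_mono) (blast, simp)
    moreover have "r x + r y \<le> r (sup x y) + r (inf x y)"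
      using r_supermodular xy unfolding supermodular_on_def by blast
    ultimately show "r x + \<beta> * ?I x + (r y + \<beta> * ?I y) \<le> r (sup x y) + \<beta> * ?I (sup x y) + (r (inf x y) + \<beta> * ?I (inf x y))"
      by (simp add: distrib_left)
  qed
qed

text \<open>Blackwell's two conditions, monotonicity and discounting, in a single inequality. The
  constant passes through the integral because \<open>p x\<close> has mass one.\<close>

lemma action_value_mono:
  assumes f: "admissible f" "admissible g" and le: "\<And>s. s \<in> S \<Longrightarrow> f s \<le> g s + d" and x: "x \<in> S \<times> A"
  shows "action_value f x \<le> action_value g x + \<beta> * d"
proof -
  interpret prob_space "p x" using x by (rule p_prob_space)
  have "(\<integral>s'. f s' \<partial>p x) \<le> (\<integral>s'. g s' + d \<partial>p x)"
    using le admissible_integrable[OF f(1) x] admissible_integrable[OF f(2) x]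
    by (intro integral_mono Bochner_Integration.integrable_add) (auto simp: p_space[OF x])
  also have "\<dots> = (\<integral>s'. g s' \<partial>p x) + d"
    using admissible_integrable[OF f(2) x] by (simp add: prob_space)
  finally have "\<beta> * (\<integral>s'. f s' \<partial>p x) \<le> \<beta> * ((\<integral>s'. g s' \<partial>p x) + d)"
    using \<beta>_pos by simp
  then show ?thesis by (simp add: action_value_def distrib_left)
qed

lemma action_value_slice_usc:
  assumes "admissible f" "s \<in> S"
  shows "usc_on (\<Gamma> s) (\<lambda>a. action_value f (s, a))"
  using assms \<Gamma>[of s] by (intro usc_on_compose[OF action_value_usc] continuous_intros) auto

text \<open>The slice \<open>\<Gamma> s\<close> is compact and the action value upper
  semi-continuous on it, so the supremum in \<open>bellman\<close> is a maximum.\<close>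

lemma bellman_upper_and_attained:
  assumes f: "admissible f" and s: "s \<in> S"
  shows bellman_upper: "a \<in> \<Gamma> s \<Longrightarrow> action_value f (s, a) \<le> bellman f s"
    and bellman_attained: "\<exists>a\<in>\<Gamma> s. bellman f s = action_value f (s, a)"
proof -
  obtain m where m: "m \<in> \<Gamma> s" "\<And>b. b \<in> \<Gamma> s \<Longrightarrow> action_value f (s, b) \<le> action_value f (s, m)"
    by (rule usc_on_attains_max[OF _ _ action_value_slice_usc[OF f s]]) (use \<Gamma>[OF s] in auto)
  then have eq: "bellman f s = action_value f (s, m)"
    unfolding bellman_def by (intro cSup_eq_maximum) auto
  show "\<exists>a\<in>\<Gamma> s. bellman f s = action_value f (s, a)" using m(1) eq by blast
  show "action_value f (s, a) \<le> bellman f s" if "a \<in> \<Gamma> s" using m(2)[OF that] eq by simp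
qed

lemma bellman_less_iff:
  assumes f: "admissible f" and s: "s \<in> S"
  shows "bellman f s < c \<longleftrightarrow> (\<forall>a\<in>\<Gamma> s. action_value f (s, a) < c)"
  using bellman_attained[OF f s] bellman_upper[OF f s] le_less_trans by metis

text \<open>Semi-continuity is the fibre bound with \<open>C = UNIV\<close>. For supermodularity,
  take maximizers at \<open>s\<close> and \<open>t\<close>: their join and meet are feasible at the
  join and meet of the states, hence bounded there by \<open>bellman f\<close>.\<close>

lemma admissible_bellman:
  assumes f: "admissible f"
  shows "admissible (bellman f)"
  unfolding admissible_def
proof (intro conjI)
  show "usc_on S (bellman f)"
    unfolding usc_on_def
  proof
    fix c
    have "{s \<in> S. bellman f s < c} = {s \<in> S. \<forall>a\<in>\<Gamma> s \<inter> UNIV. action_value f (s, a) < c}"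
      using bellman_less_iff[OF f] by auto
    also have "openin (top_of_set S) \<dots>"
      using \<Gamma> by (intro openin_bound_on_fibres[OF action_value_usc[OF f] \<Gamma>_usc]) auto
    finally show "openin (top_of_set S) {s \<in> S. bellman f s < c}" .
  qed
  obtain B where B: "\<And>x. x \<in> S \<times> A \<Longrightarrow> \<bar>action_value f x\<bar> \<le> B"
    using f by (rule action_value_bounded) blast
  have "\<bar>bellman f s\<bar> \<le> B" if s: "s \<in> S" for s
  proof -
    obtain a where "a \<in> \<Gamma> s" "bellman f s = action_value f (s, a)"
      using bellman_attained[OF f s] by blast
    then show ?thesis using B[of "(s, a)"] s \<Gamma>[OF s] by auto
  qed
  then show "bounded (bellman f ` S)" by (auto simp: bounded_iff)
  show "supermodular_on S (bellman f)"
    unfolding supermodular_on_def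
  proof (intro ballI)
    fix s t assume st: "s \<in> S" "t \<in> S"
    obtain a where a: "a \<in> \<Gamma> s" "bellman f s = action_value f (s, a)"
      using bellman_attained[OF f st(1)] by blast
    obtain b where b: "b \<in> \<Gamma> t" "bellman f t = action_value f (t, b)"
      using bellman_attained[OF f st(2)] by blast
    have "sup a b \<in> \<Gamma> (sup s t)" "inf a b \<in> \<Gamma> (inf s t)"
      using \<Gamma>_supermodular st a b by (auto simp: supermodular_corr_def)
    moreover have "sup s t \<in> S" "inf s t \<in> S" using S_lattice st by (auto simp: is_lattice_def)
    ultimately have "action_value f (sup s t, sup a b) \<le> bellman f (sup s t)"
      "action_value f (inf s t, inf a b) \<le> bellman f (inf s t)"
      using bellman_upper[OF f] by auto
    moreover have "action_value f (s, a) + action_value f (t, b)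
        \<le> action_value f (sup s t, sup a b) + action_value f (inf s t, inf a b)"
    proof -
      have "(s, a) \<in> S \<times> A" "(t, b) \<in> S \<times> A" using st a b \<Gamma> by auto
      with action_value_supermodular[OF f]
      have "action_value f (s, a) + action_value f (t, b)
          \<le> action_value f (sup (s, a) (t, b)) + action_value f (inf (s, a) (t, b))"
        unfolding supermodular_on_def by blast
      then show ?thesis by (simp add: sup_prod_def inf_prod_def)
    qed
    ultimately show "bellman f s + bellman f t \<le> bellman f (sup s t) + bellman f (inf s t)"
      using a b by linarith
  qed
qed

section \<open>Contraction and fixed point of the Bellman operator\<close>

lemma bellman_contraction:
  assumes f: "admissible f" "admissible g" and d: "\<And>s. s \<in> S \<Longrightarrow> \<bar>f s - g s\<bar> \<le> d" and s: "s \<in> S"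
  shows "\<bar>bellman f s - bellman g s\<bar> \<le> \<beta> * d"
proof -
  \<comment> \<open>A maximizer for \<open>f\<close> is a candidate for \<open>g\<close>. The
    one-sided bound is proved for arbitrary pairs, to be used in both directions.\<close>
  have "bellman f s \<le> bellman g s + \<beta> * d"
    if fg: "admissible f" "admissible g" and d: "\<And>s. s \<in> S \<Longrightarrow> \<bar>f s - g s\<bar> \<le> d" for f g
  proof -
    obtain a where a: "a \<in> \<Gamma> s" "bellman f s = action_value f (s, a)"
      using bellman_attained[OF fg(1) s] by blast
    have "f s \<le> g s + d" if "s \<in> S" for s using d[OF that] by linarith
    moreover have "(s, a) \<in> S \<times> A" using s a(1) \<Gamma>[OF s] by auto
    ultimately have "action_value f (s, a) \<le> action_value g (s, a) + \<beta> * d"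
      using fg by (intro action_value_mono) auto
    then show ?thesis using a bellman_upper[OF fg(2) s a(1)] by linarith
  qed
  from this[of f g] this[of g f] have "bellman f s \<le> bellman g s + \<beta> * d" "bellman g s \<le> bellman f s + \<beta> * d"
    using f d by (auto simp: abs_minus_commute)
  then show ?thesis by linarith
qed

lemma admissible_uniform_limit:
  assumes f: "\<And>n. admissible (f n)" and lim: "uniform_limit S f g sequentially"
  shows "admissible g"
  unfolding admissible_def
proof (intro conjI)
  show "usc_on S g" using f by (intro usc_on_uniform_limit[OF _ lim]) (simp add: admissible_def)
  \<comment> \<open>A single approximant within distance 1 transfers its bound to \<open>g\<close>,
    enlarged by 1.\<close>
  obtain n where n: "\<And>s. s \<in> S \<Longrightarrow> dist (f n s) (g s) < 1"
    using uniform_limitD[OF lim, of 1] by (auto simp: eventually_sequentially)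
  obtain B where B: "\<And>s. s \<in> S \<Longrightarrow> \<bar>f n s\<bar> \<le> B"
    using f[of n] by (auto simp: admissible_def bounded_iff)
  have "\<bar>g s\<bar> \<le> B + 1" if "s \<in> S" for s
    using n[OF that] B[OF that] by (simp add: dist_real_def)
  then show "bounded (g ` S)" by (auto simp: bounded_iff)
  have pointwise: "(\<lambda>n. f n s) \<longlonglongrightarrow> g s" if "s \<in> S" for s
    using tendsto_uniform_limitI[OF lim that] .
  show "supermodular_on S g"
    unfolding supermodular_on_def
  proof (intro ballI)
    fix s t assume st: "s \<in> S" "t \<in> S"
    have "sup s t \<in> S" "inf s t \<in> S" using S_lattice st by (auto simp: is_lattice_def)
    then have "(\<lambda>n. f n (sup s t) + f n (inf s t)) \<longlonglongrightarrow> g (sup s t) + g (inf s t)"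
      by (intro tendsto_add pointwise)
    moreover have "(\<lambda>n. f n s + f n t) \<longlonglongrightarrow> g s + g t"
      using st by (intro tendsto_add pointwise)
    moreover have "f n s + f n t \<le> f n (sup s t) + f n (inf s t)" for n
      using f[of n] st by (simp add: admissible_def supermodular_on_def)
    ultimately show "g s + g t \<le> g (sup s t) + g (inf s t)"
      by (intro LIMSEQ_le) auto
  qed
qed

text \<open>Banach's iteration started at the zero function. Uniform convergence on \<open>S\<close>
  keeps the limit admissible.\<close>

lemma bellman_fixed_point:
  obtains W where "admissible W" "\<And>s. s \<in> S \<Longrightarrow> bellman W s = W s"
proof -
  define f where "f n = (bellman ^^ n) (\<lambda>_. 0)" for n
  have f_Suc: "f (Suc n) = bellman (f n)" for n by (simp add: f_def)
  have adm: "admissible (f n)" for n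
  proof (induction n)
    case 0
    have "openin (top_of_set S) {x \<in> S. 0 < (c::real)}" for c by (cases "0 < c") simp_all
    then show ?case by (simp add: f_def admissible_def usc_on_def supermodular_on_def bounded_iff exI[of _ 0])
  next
    case (Suc n)
    then show ?case by (simp add: f_Suc admissible_bellman)
  qed
  \<comment> \<open>\<open>K\<close> bounds the first increment, since \<open>f 0\<close>
    vanishes.\<close>
  obtain K where K: "\<And>s. s \<in> S \<Longrightarrow> \<bar>f 1 s\<bar> \<le> K"
    using adm[of 1] by (auto simp: admissible_def bounded_iff)
  have diff: "\<bar>f (Suc n) s - f n s\<bar> \<le> \<beta> ^ n * K" if "s \<in> S" for n s
    using that
  proof (induction n arbitrary: s)
    case 0
    then show ?case using K by (simp add: f_def)
  next
    case (Suc n)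
    then show ?case
      using bellman_contraction[OF adm[of "Suc n"] adm[of n]] by (simp add: f_Suc mult.assoc)
  qed
  \<comment> \<open>The limit is written as the series of increments, to which the Weierstrass test
    applies. As \<open>f 0 = 0\<close>, the partial sums telescope to \<open>f n\<close>
    itself.\<close>
  define W where "W s = (\<Sum>n. f (Suc n) s - f n s)" for s
  have "uniform_limit S (\<lambda>n s. \<Sum>i<n. f (Suc i) s - f i s) W sequentially"
    unfolding W_def
    using diff \<beta>_pos \<beta>_less_1
    by (intro Weierstrass_m_test[where M="\<lambda>n. \<beta> ^ n * K"] summable_mult2 summable_geometric) auto
  moreover have "(\<Sum>i<n. f (Suc i) s - f i s) = f n s" for n s
    using sum_lessThan_telescope[of "\<lambda>i. f i s" n] by (simp add: f_def)
  ultimately have lim: "uniform_limit S f W sequentially" by simp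
  have W: "admissible W" using adm lim by (rule admissible_uniform_limit)
  have "bellman W s = W s" if s: "s \<in> S" for s
  proof -
    \<comment> \<open>The contraction carries the uniform convergence through
      \<open>bellman\<close>; comparison with the limit of the shifted sequence then gives the fixed
      point equation.\<close>
    have "(\<lambda>n. f (Suc n) s) \<longlonglongrightarrow> bellman W s"
    proof (rule LIMSEQ_I)
      fix e :: real assume "0 < e"
      from uniform_limitD[OF lim this] obtain m where m: "\<And>n s. n \<ge> m \<Longrightarrow> s \<in> S \<Longrightarrow> dist (f n s) (W s) < e"
        by (auto simp: eventually_sequentially)
      have "norm (f (Suc n) s - bellman W s) < e" if "n \<ge> m" for n
      proof -
        have "\<bar>bellman (f n) s - bellman W s\<bar> \<le> \<beta> * e"
          using m[OF that] s by (intro bellman_contraction adm W) (auto simp: dist_real_def less_imp_le)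
        also have "\<dots> < e" using \<beta>_less_1 \<open>0 < e\<close> by simp
        finally show ?thesis by (simp add: f_Suc)
      qed
      then show "\<exists>m. \<forall>n\<ge>m. norm (f (Suc n) s - bellman W s) < e" by blast
    qed
    moreover have "(\<lambda>n. f (Suc n) s) \<longlonglongrightarrow> W s"
      using tendsto_uniform_limitI[OF lim s] by (rule LIMSEQ_Suc)
    ultimately show ?thesis by (rule LIMSEQ_unique)
  qed
  with W show thesis by (rule that)
qed

section \<open>Maximizers and their measurable selection\<close>

lemma maximizersD:
  assumes "admissible f" "s \<in> S" "a \<in> maximizers f s"
  shows "a \<in> \<Gamma> s" "action_value f (s, a) = bellman f s"
  using assms bellman_upper by (auto simp: maximizers_def antisym)

text \<open>For \<open>s \<le> t\<close>, the join and meet of the states are \<open>t\<close> and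
  \<open>s\<close>. Supermodularity makes the action values of \<open>sup a b\<close> at
  \<open>t\<close> and \<open>inf a b\<close> at \<open>s\<close> add up to at least the two maxima,
  while neither exceeds its own maximum; so both attain it.\<close>

lemma ascending_maximizers:
  assumes f: "admissible f"
  shows "ascending_on S (maximizers f)"
  unfolding ascending_on_def
proof (intro ballI impI)
  fix s t a b assume st: "s \<in> S" "t \<in> S" "s \<le> t" and a: "a \<in> maximizers f t" and b: "b \<in> maximizers f s"
  note aD = maximizersD[OF f st(2) a] and bD = maximizersD[OF f st(1) b]
  have [simp]: "sup t s = t" "inf t s = s" using st by (auto simp: sup.absorb1 inf.absorb2)
  have "sup a b \<in> \<Gamma> (sup t s)" "inf a b \<in> \<Gamma> (inf t s)"
    using \<Gamma>_supermodular st aD(1) bD(1) unfolding supermodular_corr_def by blast+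
  then have feas: "sup a b \<in> \<Gamma> t" "inf a b \<in> \<Gamma> s" by simp_all
  have "action_value f (t, a) + action_value f (s, b)
      \<le> action_value f (sup (t, a) (s, b)) + action_value f (inf (t, a) (s, b))"
  proof -
    have "(t, a) \<in> S \<times> A" "(s, b) \<in> S \<times> A" using st aD(1) bD(1) \<Gamma> by auto
    then show ?thesis using action_value_supermodular[OF f] unfolding supermodular_on_def by blast
  qed
  then have "action_value f (t, a) + action_value f (s, b)
      \<le> action_value f (t, sup a b) + action_value f (s, inf a b)"
    by (simp add: sup_prod_def inf_prod_def)
  with bellman_upper[OF f st(2) feas(1)] bellman_upper[OF f st(1) feas(2)]
  show "sup a b \<in> maximizers f t \<and> inf a b \<in> maximizers f s"
    using feas aD bD by (simp add: maximizers_def)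
qed

lemma greatest_maximizer:
  assumes f: "admissible f" and s: "s \<in> S"
  obtains m where "m \<in> maximizers f s" "\<And>a. a \<in> maximizers f s \<Longrightarrow> a \<le> m"
proof (rule compact_lattice_has_greatest[of "maximizers f s"])
  show "compact (maximizers f s)"
    unfolding maximizers_def using \<Gamma>[OF s]
    by (intro usc_on_compact_superlevel action_value_slice_usc f s) auto
  show "maximizers f s \<noteq> {}"
    using bellman_attained[OF f s] by (auto simp: maximizers_def)
  \<comment> \<open>Ascending with both states equal to \<open>s\<close> is closure under join and
    meet.\<close>
  show "is_lattice (maximizers f s)"
    using ascending_maximizers[OF f] s by (simp add: ascending_on_def is_lattice_def)
qed (use that in blast)

definition selector :: "('s \<Rightarrow> real) \<Rightarrow> 's \<Rightarrow> 'a" where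
  "selector f s = (SOME m. m \<in> maximizers f s \<and> (\<forall>a\<in>maximizers f s. a \<le> m))"

lemma selector:
  assumes "admissible f" "s \<in> S"
  shows "selector f s \<in> maximizers f s" "a \<in> maximizers f s \<Longrightarrow> a \<le> selector f s"
proof -
  have "\<exists>m. m \<in> maximizers f s \<and> (\<forall>a\<in>maximizers f s. a \<le> m)"
    using assms by (metis greatest_maximizer)
  from someI_ex[OF this]
  show "selector f s \<in> maximizers f s" "a \<in> maximizers f s \<Longrightarrow> a \<le> selector f s"
    by (auto simp: selector_def)
qed

text \<open>
  No maximizer lies in \<open>C\<close> iff some rational strictly separates the maximum over \<open>\<Gamma> s \<inter> C\<close> from
  the one over \<open>\<Gamma> s\<close>.
\<close>

lemma maximizers_hit_measurable:
  assumes f: "admissible f" and C: "closed C"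
  shows "{s \<in> S. maximizers f s \<inter> C \<noteq> {}} \<in> sets (borel_of_set S)"
proof -
  let ?miss = "\<lambda>q. {s \<in> S. q \<le> bellman f s} \<inter> {s \<in> S. \<forall>a\<in>\<Gamma> s \<inter> C. action_value f (s, a) < q}"
  have "?miss q \<in> sets (borel_of_set S)" for q
  proof (rule sets.Int)
    show "{s \<in> S. q \<le> bellman f s} \<in> sets (borel_of_set S)"
      using admissible_measurable[OF admissible_bellman[OF f]]
      by (simp add: borel_measurable_iff_ge space_restrict_space)
    show "{s \<in> S. \<forall>a\<in>\<Gamma> s \<inter> C. action_value f (s, a) < q} \<in> sets (borel_of_set S)"
      using \<Gamma> by (intro openin_measurable openin_bound_on_fibres[OF action_value_usc[OF f] \<Gamma>_usc] C) auto
  qed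
  then have "space (borel_of_set S) - (\<Union>q\<in>\<rat>. ?miss q) \<in> sets (borel_of_set S)"
    by (intro sets.Diff sets.top sets.countable_UN' countable_rat) auto
  also have "space (borel_of_set S) - (\<Union>q\<in>\<rat>. ?miss q) = {s \<in> S. maximizers f s \<inter> C \<noteq> {}}"
  proof -
    have "(\<exists>q\<in>\<rat>. s \<in> ?miss q) \<longleftrightarrow> maximizers f s \<inter> C = {}" if s: "s \<in> S" for s
    proof
      assume "\<exists>q\<in>\<rat>. s \<in> ?miss q"
      then show "maximizers f s \<inter> C = {}" by (force simp: maximizers_def)
    next
      assume empty: "maximizers f s \<inter> C = {}"
      \<comment> \<open>If \<open>\<Gamma> s \<inter> C\<close> is nonempty, \<open>m\<close> is its
        maximal action value, below \<open>bellman f s\<close> because no maximizer lies in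
        \<open>C\<close>; otherwise any smaller number will do.\<close>
      have "\<exists>m<bellman f s. \<forall>a\<in>\<Gamma> s \<inter> C. action_value f (s, a) \<le> m"
      proof (cases "\<Gamma> s \<inter> C = {}")
        case True
        then show ?thesis by (metis empty_iff lt_ex)
      next
        case False
        have "compact (\<Gamma> s \<inter> C)" using \<Gamma>[OF s] C by (simp add: compact_Int_closed)
        then obtain b where "b \<in> \<Gamma> s \<inter> C" "\<And>a. a \<in> \<Gamma> s \<inter> C \<Longrightarrow> action_value f (s, a) \<le> action_value f (s, b)"
          using usc_on_attains_max[OF _ False usc_on_subset[OF action_value_slice_usc[OF f s]]] by (metis Int_lower1)
        then show ?thesis using empty by (intro exI[of _ "action_value f (s, b)"]) (auto simp: maximizers_def)
      qed
      then obtain m where m: "m < bellman f s" "\<And>a. a \<in> \<Gamma> s \<inter> C \<Longrightarrow> action_value f (s, a) \<le> m" by blast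
      obtain q where q: "q \<in> \<rat>" "m < q" "q < bellman f s" using Rats_dense_in_real[OF m(1)] by blast
      have "action_value f (s, a) < q" if "a \<in> \<Gamma> s \<inter> C" for a
        using m(2)[OF that] q(2) by simp
      with s q(3) have "s \<in> ?miss q" by simp
      with q(1) show "\<exists>q\<in>\<rat>. s \<in> ?miss q" by blast
    qed
    then show ?thesis by (auto simp: space_restrict_space)
  qed
  finally show ?thesis .
qed

text \<open>A coordinate of the greatest maximizer is at least \<open>c\<close> exactly when some
  maximizer has that coordinate at least \<open>c\<close>. Hence each coordinate reduces to hitting
  a closed half-space.\<close>

lemma selector_measurable:
  assumes f: "admissible f"
  shows "selector f \<in> borel_of_set S \<rightarrow>\<^sub>M borel_of_set A"
proof (rule measurable_restrict_space2)
  show "selector f \<in> space (borel_of_set S) \<rightarrow> A"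
    using selector(1)[OF f] \<Gamma> by (fastforce simp: space_restrict_space maximizers_def)
  show "selector f \<in> borel_measurable (borel_of_set S)"
  proof (subst borel_measurable_euclidean_space, intro ballI borel_measurable_iff_ge[THEN iffD2] allI)
    fix b :: 'a and c assume b: "b \<in> Basis"
    have "c \<le> selector f s \<bullet> b \<longleftrightarrow> maximizers f s \<inter> {x. c \<le> x \<bullet> b} \<noteq> {}" if s: "s \<in> S" for s
    proof
      show "c \<le> selector f s \<bullet> b \<Longrightarrow> maximizers f s \<inter> {x. c \<le> x \<bullet> b} \<noteq> {}"
        using selector(1)[OF f s] by blast
      assume "maximizers f s \<inter> {x. c \<le> x \<bullet> b} \<noteq> {}"
      then obtain a where a: "a \<in> maximizers f s" "c \<le> a \<bullet> b" by blast
      from selector(2)[OF f s a(1)] b have "a \<bullet> b \<le> selector f s \<bullet> b" by (simp add: eucl_le[where 'a='a])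
      with a(2) show "c \<le> selector f s \<bullet> b" by simp
    qed
    then have "{s \<in> space (borel_of_set S). c \<le> selector f s \<bullet> b} = {s \<in> S. maximizers f s \<inter> {x. c \<le> x \<bullet> b} \<noteq> {}}"
      by (auto simp: space_restrict_space)
    also have "\<dots> \<in> sets (borel_of_set S)"
      by (intro maximizers_hit_measurable f closed_Collect_le continuous_intros)
    finally show "{s \<in> space (borel_of_set S). c \<le> selector f s \<bullet> b} \<in> sets (borel_of_set S)" .
  qed
qed

lemma stationary_strategy:
  assumes f: "admissible f"
  shows "(\<lambda>t h. selector f) \<in> strategies S A \<Gamma>"
  using selector(1)[OF f] measurable_compose[OF measurable_snd selector_measurable[OF f]]
  by (auto simp: strategies_def split_beta' maximizers_def)

subsection \<open>The value function\<close>

text \<open>The gap between the value of a strategy and \<open>W\<close> is the discounted sum of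
  expected one-period losses. This is an identity for every admissible \<open>W\<close>; the Bellman
  equation enters later, through the sign of the losses.\<close>

lemma strategy_value_loss:
  assumes W: "admissible W" and \<sigma>: "\<sigma> \<in> strategies S A \<Gamma>" and s\<^sub>0: "s\<^sub>0 \<in> S"
  shows "(\<lambda>t. \<beta> ^ t * (\<integral>\<omega>. action_value W (\<omega> t) - W (fst (\<omega> t)) \<partial>process_law S A p \<sigma> s\<^sub>0))
    sums (strategy_value S A p r \<beta> \<sigma> s\<^sub>0 - W s\<^sub>0)"
proof -
  interpret controlled_process S A \<Gamma> p \<sigma> s\<^sub>0
    using p \<sigma> s\<^sub>0 by unfold_locales
  define \<mu> where "\<mu> = process_law S A p \<sigma> s\<^sub>0"
  interpret \<mu>: prob_space \<mu> unfolding \<mu>_def by (rule prob_space_process_law)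
  obtain R where R: "\<And>x. x \<in> S \<times> A \<Longrightarrow> \<bar>r x\<bar> \<le> R"
    using r_bounded by (auto simp: bounded_iff)
  obtain K where K: "\<And>s. s \<in> S \<Longrightarrow> \<bar>W s\<bar> \<le> K"
    using W by (auto simp: admissible_def bounded_iff)
  obtain J where J: "\<And>x. x \<in> S \<times> A \<Longrightarrow> \<bar>\<integral>s'. W s' \<partial>p x\<bar> \<le> J"
    using integral_p_bounded[OF W] by blast
  have comp: "\<omega> t \<in> S \<times> A" if "\<omega> \<in> space \<mu>" for \<omega> t
    using that by (auto simp: \<mu>_def space_process_law)
  have W_fst: "(\<lambda>x. W (fst x)) \<in> borel_measurable N"
    using measurable_compose[OF measurable_fst admissible_measurable[OF W]] .
  have W_int: "(\<lambda>x. \<integral>s'. W s' \<partial>p x) \<in> borel_measurable N"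
    using measurable_compose[OF measurable_p integral_measurable_subprob_algebra[OF admissible_measurable[OF W]]] .
  define \<rho> where "\<rho> t = (\<integral>\<omega>. r (\<omega> t) \<partial>\<mu>)" for t
  define u where "u t = (\<integral>\<omega>. W (fst (\<omega> t)) \<partial>\<mu>)" for t
  have int_r: "integrable \<mu> (\<lambda>\<omega>. r (\<omega> t))" for t
    unfolding \<mu>_def using r_measurable R by (rule integrable_process_component)
  have int_W: "integrable \<mu> (\<lambda>\<omega>. W (fst (\<omega> t)))" for t
    unfolding \<mu>_def using K by (intro integrable_process_component W_fst) auto
  have int_pW: "integrable \<mu> (\<lambda>\<omega>. \<integral>s'. W s' \<partial>p (\<omega> t))" for t
    unfolding \<mu>_def using W_int J by (rule integrable_process_component)
  \<comment> \<open>The state of period \<open>t + 1\<close> is drawn from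
    \<open>p (\<omega> t)\<close>, so expected continuation values are expectations of
    \<open>W\<close> one period later.\<close>
  have u_Suc: "u (Suc t) = (\<integral>\<omega>. (\<integral>s'. W s' \<partial>p (\<omega> t)) \<partial>\<mu>)" for t
    using integral_process_component[OF W_fst, of K "Suc t"] K by (auto simp: u_def \<mu>_def)
  have u_0: "u 0 = W s\<^sub>0"
    using integral_process_component[OF W_fst, of K 0] K s\<^sub>0 admissible_measurable[OF W]
    by (auto simp: u_def \<mu>_def[symmetric] integral_return space_restrict_space \<mu>.prob_space)
  have loss: "(\<integral>\<omega>. action_value W (\<omega> t) - W (fst (\<omega> t)) \<partial>\<mu>) = \<rho> t + \<beta> * u (Suc t) - u t" for t
    unfolding action_value_def u_Suc unfolding u_def \<rho>_def using int_r int_W int_pW by simp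
  \<comment> \<open>The term \<open>\<beta> ^ t * \<beta> * u (Suc t)\<close> cancels against the
    next summand, which leaves only the two boundary terms.\<close>
  have partial: "(\<Sum>t<n. \<beta> ^ t * (\<rho> t + \<beta> * u (Suc t) - u t)) = (\<Sum>t<n. \<beta> ^ t * \<rho> t) + \<beta> ^ n * u n - W s\<^sub>0" for n
    by (induction n) (simp_all add: u_0 algebra_simps)
  have "\<bar>u t\<bar> \<le> K" for t
  proof -
    have "\<bar>u t\<bar> \<le> (\<integral>\<omega>. \<bar>W (fst (\<omega> t))\<bar> \<partial>\<mu>)" unfolding u_def by (rule integral_abs_bound)
    also have "\<dots> \<le> (\<integral>\<omega>. K \<partial>\<mu>)"
      using int_W K comp by (intro integral_mono) (auto simp: mem_Times_iff)
    finally show ?thesis by (simp add: \<mu>.prob_space)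
  qed
  then have tail: "(\<lambda>n. \<beta> ^ n * u n) \<longlonglongrightarrow> 0"
    using \<beta>_pos \<beta>_less_1 by (intro lim_null_mult_right_bounded[where B=K] always_eventually) (auto intro: LIMSEQ_realpow_zero)
  \<comment> \<open>Sum and expectation are exchanged under domination by the geometric series
    \<open>\<beta> ^ t * R\<close>.\<close>
  have "(\<lambda>t. \<integral>\<omega>. \<beta> ^ t * r (\<omega> t) \<partial>\<mu>) sums (\<integral>\<omega>. (\<Sum>t. \<beta> ^ t * r (\<omega> t)) \<partial>\<mu>)"
  proof (rule sums_integral)
    have geom: "summable (\<lambda>t. \<beta> ^ t * R)"
      using \<beta>_pos \<beta>_less_1 by (intro summable_mult2 summable_geometric) auto
    show int: "integrable \<mu> (\<lambda>\<omega>. \<beta> ^ t * r (\<omega> t))" for t using int_r by simp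
    have bound: "norm (\<beta> ^ t * r (\<omega> t)) \<le> \<beta> ^ t * R" if "\<omega> \<in> space \<mu>" for t \<omega>
      using R[OF comp[OF that]] \<beta>_pos by (simp add: abs_mult)
    show "AE \<omega> in \<mu>. summable (\<lambda>t. norm (\<beta> ^ t * r (\<omega> t)))"
      using bound by (intro AE_I2 summable_comparison_test'[OF geom]) auto
    have "(\<integral>\<omega>. norm (\<beta> ^ t * r (\<omega> t)) \<partial>\<mu>) \<le> \<beta> ^ t * R" for t
    proof -
      have "(\<integral>\<omega>. norm (\<beta> ^ t * r (\<omega> t)) \<partial>\<mu>) \<le> (\<integral>\<omega>. \<beta> ^ t * R \<partial>\<mu>)"
        using bound int by (intro integral_mono) auto
      then show ?thesis by (simp add: \<mu>.prob_space)
    qed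
    then show "summable (\<lambda>t. \<integral>\<omega>. norm (\<beta> ^ t * r (\<omega> t)) \<partial>\<mu>)"
      by (intro summable_comparison_test'[OF geom]) (simp add: integral_nonneg_AE)
  qed
  then have "(\<lambda>n. \<Sum>t<n. \<beta> ^ t * \<rho> t) \<longlonglongrightarrow> strategy_value S A p r \<beta> \<sigma> s\<^sub>0"
    by (simp add: sums_def \<rho>_def strategy_value_def \<mu>_def)
  from tendsto_diff[OF tendsto_add[OF this tail] tendsto_const[of "W s\<^sub>0"]]
  show ?thesis
    unfolding \<mu>_def[symmetric] loss by (simp add: sums_def partial)
qed

text \<open>Conditioning on the history reduces the loss to the value of one feasible action minus
  \<open>W s = bellman W s\<close>. It is nonpositive, and zero when the action is a
  maximizer.\<close>

lemma integral_loss: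
  assumes W: "admissible W" "\<And>s. s \<in> S \<Longrightarrow> bellman W s = W s"
    and \<sigma>: "\<sigma> \<in> strategies S A \<Gamma>" and s\<^sub>0: "s\<^sub>0 \<in> S"
  shows "(\<integral>\<omega>. action_value W (\<omega> t) - W (fst (\<omega> t)) \<partial>process_law S A p \<sigma> s\<^sub>0) \<le> 0"
    and "(\<And>h s. s \<in> S \<Longrightarrow> \<sigma> t h s \<in> maximizers W s) \<Longrightarrow>
      (\<integral>\<omega>. action_value W (\<omega> t) - W (fst (\<omega> t)) \<partial>process_law S A p \<sigma> s\<^sub>0) = 0"
proof -
  interpret controlled_process S A \<Gamma> p \<sigma> s\<^sub>0
    using p \<sigma> s\<^sub>0 by unfold_locales
  let ?f = "\<lambda>x. action_value W x - W (fst x)"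
  let ?\<mu> = "process_law S A p \<sigma> s\<^sub>0"
  obtain B where B: "\<And>x. x \<in> S \<times> A \<Longrightarrow> \<bar>action_value W x\<bar> \<le> B"
    using action_value_bounded[OF W(1)] by blast
  obtain K where K: "\<And>s. s \<in> S \<Longrightarrow> \<bar>W s\<bar> \<le> K"
    using W by (auto simp: admissible_def bounded_iff)
  have f_bounded: "\<bar>?f x\<bar> \<le> B + K" if "x \<in> S \<times> A" for x
    using B[OF that] K[of "fst x"] that by (auto simp: abs_le_iff)
  have f_measurable: "?f \<in> borel_measurable N"
    unfolding action_value_def
    using measurable_compose[OF measurable_p integral_measurable_subprob_algebra[OF admissible_measurable[OF W(1)]]]
      measurable_compose[OF measurable_fst admissible_measurable[OF W(1)]] r_measurable
    by (intro borel_measurable_diff borel_measurable_add borel_measurable_times) auto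
  have step: "(\<integral>\<omega>. ?f (\<omega> t) \<partial>?\<mu>) = (\<integral>\<omega>. (\<integral>s. ?f (s, \<sigma> t (restrict \<omega> {0..<t}) s) \<partial>next_state t \<omega>) \<partial>?\<mu>)"
    using f_measurable f_bounded by (rule integral_process_component)
  have hist: "restrict \<omega> {0..<t} \<in> space (PiM {0..<t} (\<lambda>_. N))" if "\<omega> \<in> space ?\<mu>" for \<omega>
    using that by (auto simp: space_process_law space_PiM PiE_iff space_N)
  have next_space: "space (next_state t \<omega>) = S" if "\<omega> \<in> space ?\<mu>" for \<omega>
    using next_state_space(3)[OF hist[OF that]] by (cases t) auto
  have "?f (s, \<sigma> t (restrict \<omega> {0..<t}) s) \<le> 0" if "\<omega> \<in> space ?\<mu>" "s \<in> S" for \<omega> s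
    using bellman_upper[OF W(1) that(2) strategy_feasible[OF hist[OF that(1)] that(2)]] W(2)[OF that(2)] by simp
  then have "(\<integral>s. ?f (s, \<sigma> t (restrict \<omega> {0..<t}) s) \<partial>next_state t \<omega>) \<le> 0" if "\<omega> \<in> space ?\<mu>" for \<omega>
    using that by (intro integral_nonpos) (simp add: next_space)
  then show "(\<integral>\<omega>. ?f (\<omega> t) \<partial>?\<mu>) \<le> 0"
    unfolding step by (rule integral_nonpos)
  assume "\<And>h s. s \<in> S \<Longrightarrow> \<sigma> t h s \<in> maximizers W s"
  then have zero: "?f (s, \<sigma> t h s) = 0" if "s \<in> S" for s h
    using maximizersD(2)[OF W(1) that] W(2)[OF that] that by simp
  have "(\<integral>s. ?f (s, \<sigma> t (restrict \<omega> {0..<t}) s) \<partial>next_state t \<omega>) = (\<integral>s. 0 \<partial>next_state t \<omega>)"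
    if "\<omega> \<in> space ?\<mu>" for \<omega>
    using next_space[OF that] by (intro Bochner_Integration.integral_cong refl zero) simp
  then have "(\<integral>\<omega>. (\<integral>s. ?f (s, \<sigma> t (restrict \<omega> {0..<t}) s) \<partial>next_state t \<omega>) \<partial>?\<mu>) = (\<integral>\<omega>. 0 \<partial>?\<mu>)"
    by (intro Bochner_Integration.integral_cong refl) simp
  then show "(\<integral>\<omega>. ?f (\<omega> t) \<partial>?\<mu>) = 0"
    unfolding step by simp
qed

text \<open>Nonpositive losses make \<open>W s\<close> an upper bound; the stationary strategy that
  always plays the greatest maximizer has no losses and attains it.\<close>

lemma value_function_eq_fixed_point:
  assumes W: "admissible W" "\<And>s. s \<in> S \<Longrightarrow> bellman W s = W s" and s: "s \<in> S"
  shows "value_function S A \<Gamma> p r \<beta> s = W s"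
  unfolding value_function_def
proof (rule cSup_eq_maximum)
  let ?\<sigma> = "\<lambda>t h. selector W"
  have \<sigma>: "?\<sigma> \<in> strategies S A \<Gamma>" using W(1) by (rule stationary_strategy)
  have "(\<lambda>t. 0) sums (strategy_value S A p r \<beta> ?\<sigma> s - W s)"
    using strategy_value_loss[OF W(1) \<sigma> s] integral_loss(2)[OF W \<sigma> s] selector(1)[OF W(1)] by simp
  then have "strategy_value S A p r \<beta> ?\<sigma> s = W s"
    using sums_unique2[OF sums_zero] by fastforce
  with \<sigma> show "W s \<in> (\<lambda>\<sigma>. strategy_value S A p r \<beta> \<sigma> s) ` strategies S A \<Gamma>"
    by (metis (mono_tags, lifting) image_eqI)
next
  fix v assume "v \<in> (\<lambda>\<sigma>. strategy_value S A p r \<beta> \<sigma> s) ` strategies S A \<Gamma>"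
  then obtain \<sigma> where \<sigma>: "\<sigma> \<in> strategies S A \<Gamma>" "v = strategy_value S A p r \<beta> \<sigma> s" by blast
  have "v - W s \<le> 0"
    using integral_loss(1)[OF W \<sigma>(1) s] \<beta>_pos unfolding \<sigma>(2)
    by (intro sums_le[OF _ strategy_value_loss[OF W(1) \<sigma>(1) s] sums_zero]) (simp add: mult_nonneg_nonpos)
  then show "v \<le> W s" by simp
qed

lemma ascending_optimal_actions: "ascending_on S (optimal_actions S A \<Gamma> p r \<beta>)"
proof -
  obtain W where W: "admissible W" "\<And>s. s \<in> S \<Longrightarrow> bellman W s = W s"
    using bellman_fixed_point by blast
  have "optimal_actions S A \<Gamma> p r \<beta> s = maximizers W s" if s: "s \<in> S" for s
  proof -
    \<comment> \<open>The value function is known to agree with \<open>W\<close> on \<open>S\<close>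
      only, which is the space of \<open>p (s, a)\<close>, so the two integrals coincide.\<close>
    have "r (s, a) + \<beta> * (\<integral>s'. value_function S A \<Gamma> p r \<beta> s' \<partial>p (s, a)) = action_value W (s, a)"
      if "a \<in> \<Gamma> s" for a
      using p_space[of "(s, a)"] s \<Gamma>[OF s] that value_function_eq_fixed_point[OF W]
      unfolding action_value_def by (auto intro!: Bochner_Integration.integral_cong)
    then have "a \<in> optimal_actions S A \<Gamma> p r \<beta> s \<longleftrightarrow>
        a \<in> \<Gamma> s \<and> (\<forall>b\<in>\<Gamma> s. action_value W (s, b) \<le> action_value W (s, a))" for a
      by (auto simp: optimal_actions_def is_arg_max_linorder)
    moreover have "bellman W s \<le> action_value W (s, a) \<longleftrightarrow>
        (\<forall>b\<in>\<Gamma> s. action_value W (s, b) \<le> action_value W (s, a))" for a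
      using bellman_attained[OF W(1) s] bellman_upper[OF W(1) s] by (auto intro: order_trans)
    ultimately show ?thesis by (auto simp: maximizers_def)
  qed
  then show ?thesis
    using ascending_maximizers[OF W(1)] by (simp add: ascending_on_def)
qed

end

theorem theorem3p4:
  fixes S :: "(real ^ 'n) set" and A :: "(real ^ 'k) set"
    and \<Gamma> :: "real ^ 'n \<Rightarrow> (real ^ 'k) set"
    and p :: "(real ^ 'n) \<times> (real ^ 'k) \<Rightarrow> (real ^ 'n) measure"
    and r :: "(real ^ 'n) \<times> (real ^ 'k) \<Rightarrow> real"
    and \<beta> :: real
  assumes "S \<in> sets borel" and "uniform_space_class.complete S" and "A \<in> sets borel"
    and "0 < \<beta>" and "\<beta> < 1"
    and "transition_prob S A p"
    and "r \<in> borel_measurable (borel_of_set S \<Otimes>\<^sub>M borel_of_set A)"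
    and "bounded (r ` (S \<times> A))" and "usc_on (S \<times> A) r"
    and "usc_prob S A p"
    and "\<forall>s\<in>S. \<Gamma> s \<subseteq> A \<and> \<Gamma> s \<noteq> {} \<and> compact (\<Gamma> s)" and "usc_corr S A \<Gamma>"
    and "is_lattice S" and "is_lattice A"
    and "supermodular_on (S \<times> A) r"
    and "supermodular_prob S A p"
    and "supermodular_corr S \<Gamma>"
  shows "ascending_on S (optimal_actions S A \<Gamma> p r \<beta>)"
proof -
  interpret discounted_program S A \<Gamma> p r \<beta>
    using assms by unfold_locales auto
  show ?thesis by (rule ascending_optimal_actions)
qed

end
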